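(* Let $(\Omega_1,\dots,\Omega_M)\in\mathcal A_M$ and let $\psi:D\to\mathbb R^{M-1}$ be a vector-valued level set function representing this design, i.e. for all $l\in\{1,\dots,M\}$ and $x\in D$: $x\in\Omega_l \Longleftrightarrow \psi(x)\in S_l$. Let $G_\psi$ be the generalized topological derivative of $\mathcal J$ for the configuration $(\Omega_1,\dots,\Omega_M)$ given by $\psi$. Suppose that there exists a constant $c>0$ such that $$\psi(x)=c\,G_\psi(x)\qquad\text{for all } x\in\bigcup_{l=1}^M\Omega_l .$$ Then $(\Omega_1,\dots,\Omega_M)$ is locally optimal for the minimization of $\mathcal J$ with respect to topological changes.
   Context: Designs. Let $d\in\{1,2,3\}$, let $D\subset\mathbb R^d$ be open and bounded, let $\mathcal A$ be a given set of admissible subsets of $D$, and let $M>2$ be an integer. $\mathcal A_M$ denotes the set of tuples $(\Omega_1,\dots,\Omega_M)\in\mathcal A\times\dots\times\mathcal A$ such that each $\Omega_i$ is open, $\Omega_i\cap\Omega_j=\emptyset$ for $i\neq j$, and $\overline D=\bigcup_{l=1}^M\overline{\Omega_l}$. A multi-material shape function is a map $\mathcal J:\mathcal A_M\to\mathbb R$; one such $\mathcal J$ is fixed. Topological derivatives. Fix an open set $\omega\subset\mathbb R^d$ with $0\in\omega$ and a continuous function $\ell:\mathbb R^+\to\mathbb R^+$ with $\ell(\varepsilon)\to0$ as $\varepsilon\to0$. For $(\Omega_1,\dots,\Omega_M)\in\mathcal A_M$, $i\ne j$ and $z\in\Omega_i$, put $\omega_\varepsilon:=z+\varepsilon\omega$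 and $$\mathcal T^{i\to j}(z):=\lim_{\varepsilon\searrow0}\frac{\mathcal J(\Omega_1,\dots,\Omega_i\setminus\overline{\omega_\varepsilon},\dots,\Omega_j\cup\omega_\varepsilon,\dots,\Omega_M)-\mathcal J(\Omega_1,\dots,\Omega_M)}{\ell(\varepsilon)}.$$ It is assumed throughout that the perturbed tuples belong to $\mathcal A_M$ for small $\varepsilon$ and that these limits exist. For $x\in\Omega_i$ let $$\mathcal T^{(i)}(x):=\big(\mathcal T^{i\to1}(x),\dots,\mathcal T^{i\to i-1}(x),\mathcal T^{i\to i+1}(x),\dots,\mathcal T^{i\to M}(x)\big)^\top\in\mathbb R^{M-1},$$ and for $x\in D\setminus\bigcup_{j=1}^M\partial\Omega_j$ let $\mathcal T(x):=\sum_{i=1}^M\chi_{\Omega_i}(x)\,\mathcal T^{(i)}(x)$. Local optimality. $(\Omega_1,\dots,\Omega_M)\in\mathcal A_M$ is locally optimal for the minimization of $\mathcal J$ with respect to topological changes if $\mathcal T(x)>\mathbf 0$ componentwise in $\mathbb R^{M-1}$ for all $x\in D\setminus\bigcup_{j=1}^M\partial\Omega_j$. Sectors. $\mathbb R^{M-1}$ is divided into $M$ open convex sectors $S_1,\dots,S_M$ with $\mathbb R^{M-1}=\bigcup_{l=1}^M\overline{S_l}$. For $i\neq j$, $n^{i\to j}\in\mathbb R^{M-1}$ denotes the normal vector of the hyperplane (through the origin) separating $S_i$ from $S_j$, oriented to point out of $S_i$ and into $S_j$, so $n^{j\to i}=-n^{i\to j}$. Each sector satisfies $$S_l=\{y\in\mathbb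 R^{M-1}: y\cdot n^{j\to l}>0\ \text{ for all } j\neq l\}.$$ For each $l$, $N^{(l)}\in\mathbb R^{(M-1)\times(M-1)}$ is the matrix whose rows are $(n^{i\to l})^\top$, $i=1,\dots,l-1,l+1,\dots,M$, in this order. It is assumed throughout that $N^{(l)}$ is invertible for all $l\in\{1,\dots,M\}$. Generalized topological derivative. For a design $(\Omega_1,\dots,\Omega_M)$ and $x\in\Omega_l$ put $G_l(x):=(N^{(l)})^{-1}\mathcal T^{(l)}(x)$, and define $G:D\setminus\bigcup_{j=1}^M\partial\Omega_j\to\mathbb R^{M-1}$ by $G(x):=\sum_{l=1}^M\chi_{\Omega_l}(x)\,G_l(x)$. It is written $G_\psi$ when the design is represented by a level set function $\psi$. *)

theory Defs
  imports "HOL-Analysis.Analysis"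
begin

text \<open>
  The \<open>M\<close> materials carry the labels \<open>1, \<dots>, M\<close>, and \<open>M\<close>-tuples are extensional functions on
  \<open>{1..M}\<close>. The space of dimension \<open>M - 1\<close> is \<open>real ^ 'n\<close> with \<open>CARD('n) = M - 1\<close>; the order of
  the index type \<open>'n\<close> says which coordinate comes first, second, and so on.
\<close>

definition designs ::
  "nat \<Rightarrow> (real ^ 'd) set \<Rightarrow> (real ^ 'd) set set \<Rightarrow> (nat \<Rightarrow> (real ^ 'd) set) set"
where
  "designs M D \<A> =
    {\<Omega> \<in> {1..M} \<rightarrow>\<^sub>E \<A>.
      (\<forall>i\<in>{1..M}. open (\<Omega> i)) \<and>
      disjoint_family_on \<Omega> {1..M} \<and>
      closure D = (\<Union>l\<in>{1..M}. closure (\<Omega> l))}"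

definition inclusion :: "(real ^ 'd) set \<Rightarrow> real ^ 'd \<Rightarrow> real \<Rightarrow> (real ^ 'd) set"
where
  "inclusion \<omega> z \<epsilon> = (\<lambda>w. z + \<epsilon> *\<^sub>R w) ` \<omega>"

definition perturbed ::
  "(nat \<Rightarrow> (real ^ 'd) set) \<Rightarrow> nat \<Rightarrow> nat \<Rightarrow> (real ^ 'd) set \<Rightarrow> nat \<Rightarrow> (real ^ 'd) set"
where
  "perturbed \<Omega> i j W = \<Omega> (i := \<Omega> i - closure W, j := \<Omega> j \<union> W)"

definition difference_quotient ::
  "((nat \<Rightarrow> (real ^ 'd) set) \<Rightarrow> real) \<Rightarrow> (real ^ 'd) set \<Rightarrow> (real \<Rightarrow> real) \<Rightarrow>
    (nat \<Rightarrow> (real ^ 'd) set) \<Rightarrow> nat \<Rightarrow> nat \<Rightarrow> real ^ 'd \<Rightarrow> real \<Rightarrow> real"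
where
  "difference_quotient J \<omega> ell \<Omega> i j z \<epsilon> =
    (J (perturbed \<Omega> i j (inclusion \<omega> z \<epsilon>)) - J \<Omega>) / ell \<epsilon>"

definition topological_derivative ::
  "((nat \<Rightarrow> (real ^ 'd) set) \<Rightarrow> real) \<Rightarrow> (real ^ 'd) set \<Rightarrow> (real \<Rightarrow> real) \<Rightarrow>
    (nat \<Rightarrow> (real ^ 'd) set) \<Rightarrow> nat \<Rightarrow> nat \<Rightarrow> real ^ 'd \<Rightarrow> real"
where
  "topological_derivative J \<omega> ell \<Omega> i j z =
    Lim (at_right 0) (difference_quotient J \<omega> ell \<Omega> i j z)"

definition topologically_differentiable ::
  "nat \<Rightarrow> (real ^ 'd) set \<Rightarrow> (real ^ 'd) set set \<Rightarrow> ((nat \<Rightarrow> (real ^ 'd) set) \<Rightarrow> real) \<Rightarrow>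
    (real ^ 'd) set \<Rightarrow> (real \<Rightarrow> real) \<Rightarrow> bool"
where
  "topologically_differentiable M D \<A> J \<omega> ell \<longleftrightarrow>
    (\<forall>\<Omega>\<in>designs M D \<A>. \<forall>i\<in>{1..M}. \<forall>j\<in>{1..M} - {i}. \<forall>z\<in>\<Omega> i.
      (\<forall>\<^sub>F \<epsilon> in at_right 0. perturbed \<Omega> i j (inclusion \<omega> z \<epsilon>) \<in> designs M D \<A>) \<and>
      (\<exists>L. (difference_quotient J \<omega> ell \<Omega> i j z \<longlongrightarrow> L) (at_right 0)))"

text \<open>
  \<open>other_label M l k\<close> is the label standing at position \<open>k\<close> of the sequence
  \<open>1, \<dots>, l - 1, l + 1, \<dots>, M\<close>; \<open>card {..<k}\<close> is the zero-based position of \<open>k\<close> in \<open>'n\<close>.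
\<close>

definition other_label :: "nat \<Rightarrow> nat \<Rightarrow> 'n::{finite,linorder} \<Rightarrow> nat"
where
  "other_label M l k = sorted_list_of_set ({1..M} - {l}) ! card {..<k}"

definition topological_derivative_vec ::
  "nat \<Rightarrow> ((nat \<Rightarrow> (real ^ 'd) set) \<Rightarrow> real) \<Rightarrow> (real ^ 'd) set \<Rightarrow> (real \<Rightarrow> real) \<Rightarrow>
    (nat \<Rightarrow> (real ^ 'd) set) \<Rightarrow> nat \<Rightarrow> real ^ 'd \<Rightarrow> real ^ 'n::{finite,linorder}"
where
  "topological_derivative_vec M J \<omega> ell \<Omega> i x =
    (\<chi> k. topological_derivative J \<omega> ell \<Omega> i (other_label M i k) x)"

definition full_topological_derivative ::
  "nat \<Rightarrow> ((nat \<Rightarrow> (real ^ 'd) set) \<Rightarrow> real) \<Rightarrow> (real ^ 'd) set \<Rightarrow> (real \<Rightarrow> real) \<Rightarrow>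
    (nat \<Rightarrow> (real ^ 'd) set) \<Rightarrow> real ^ 'd \<Rightarrow> real ^ 'n::{finite,linorder}"
where
  "full_topological_derivative M J \<omega> ell \<Omega> x =
    (\<Sum>i\<in>{1..M}. indicat_real (\<Omega> i) x *\<^sub>R topological_derivative_vec M J \<omega> ell \<Omega> i x)"

text \<open>
  The type argument fixes the index type of the vector-valued derivative, which does not occur in
  the types of the other arguments.
\<close>

definition locally_optimal ::
  "'n::{finite,linorder} itself \<Rightarrow> nat \<Rightarrow> (real ^ 'd) set \<Rightarrow>
    ((nat \<Rightarrow> (real ^ 'd) set) \<Rightarrow> real) \<Rightarrow> (real ^ 'd) set \<Rightarrow> (real \<Rightarrow> real) \<Rightarrow>
    (nat \<Rightarrow> (real ^ 'd) set) \<Rightarrow> bool"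
where
  "locally_optimal TYPE('n) M D J \<omega> ell \<Omega> \<longleftrightarrow>
    (\<forall>x \<in> D - (\<Union>j\<in>{1..M}. frontier (\<Omega> j)).
      \<forall>k::'n. full_topological_derivative M J \<omega> ell \<Omega> x $ k > 0)"

text \<open>The vector \<open>n i j\<close> is normal to the hyperplane separating \<open>S i\<close> from \<open>S j\<close> and points from
  \<open>S i\<close> to \<open>S j\<close>. It is not required to have unit length.\<close>

definition sector_decomposition ::
  "nat \<Rightarrow> (nat \<Rightarrow> (real ^ 'n) set) \<Rightarrow> (nat \<Rightarrow> nat \<Rightarrow> real ^ 'n) \<Rightarrow> bool"
where
  "sector_decomposition M S n \<longleftrightarrow>
    (\<forall>l\<in>{1..M}. open (S l) \<and> convex (S l)) \<and>
    disjoint_family_on S {1..M} \<and>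
    (\<Union>l\<in>{1..M}. closure (S l)) = UNIV \<and>
    (\<forall>i\<in>{1..M}. \<forall>j\<in>{1..M} - {i}.
      n i j \<noteq> 0 \<and> n j i = - n i j \<and>
      S i \<subseteq> {y. y \<bullet> n i j < 0} \<and> S j \<subseteq> {y. y \<bullet> n i j > 0}) \<and>
    (\<forall>l\<in>{1..M}. S l = {y. \<forall>j\<in>{1..M} - {l}. y \<bullet> n j l > 0})"

definition normal_matrix ::
  "nat \<Rightarrow> (nat \<Rightarrow> nat \<Rightarrow> real ^ 'n::{finite,linorder}) \<Rightarrow> nat \<Rightarrow>
    real ^ 'n::{finite,linorder} ^ 'n::{finite,linorder}"
where
  "normal_matrix M n l = (\<chi> k. n (other_label M l k) l)"

definition generalized_topological_derivative ::
  "nat \<Rightarrow> ((nat \<Rightarrow> (real ^ 'd) set) \<Rightarrow> real) \<Rightarrow> (real ^ 'd) set \<Rightarrow> (real \<Rightarrow> real) \<Rightarrow>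
    (nat \<Rightarrow> nat \<Rightarrow> real ^ 'n::{finite,linorder}) \<Rightarrow> (nat \<Rightarrow> (real ^ 'd) set) \<Rightarrow>
    real ^ 'd \<Rightarrow> real ^ 'n::{finite,linorder}"
where
  "generalized_topological_derivative M J \<omega> ell n \<Omega> x =
    (\<Sum>l\<in>{1..M}. indicat_real (\<Omega> l) x *\<^sub>R
      (matrix_inv (normal_matrix M n l) *v topological_derivative_vec M J \<omega> ell \<Omega> l x))"

definition represents ::
  "nat \<Rightarrow> (real ^ 'd) set \<Rightarrow> (nat \<Rightarrow> (real ^ 'n) set) \<Rightarrow> (real ^ 'd \<Rightarrow> real ^ 'n) \<Rightarrow>
    (nat \<Rightarrow> (real ^ 'd) set) \<Rightarrow> bool"
where
  "represents M D S \<psi> \<Omega> \<longleftrightarrow> (\<forall>l\<in>{1..M}. \<forall>x\<in>D. x \<in> \<Omega> l \<longleftrightarrow> \<psi> x \<in> S l)"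

end

theory Submission
  imports Defs
begin

text \<open>
  At a point \<open>x\<close> of material \<open>l\<close> the generalized topological derivative is the solution \<open>g\<close> of the
  linear system \<open>N g = T\<close>, where \<open>T\<close> is the vector of topological derivatives at \<open>x\<close> and the rows
  of \<open>N\<close> are the normals pointing into the sector \<open>S l\<close>. The entries of \<open>T\<close> are thus the inner
  products of \<open>g\<close> with these normals, and they are all positive exactly when \<open>g\<close> lies in \<open>S l\<close>.
  A sector is a cone, so this is the same as \<open>c *\<^sub>R g \<in> S l\<close>, which for \<open>\<psi> x = c *\<^sub>R g\<close> says that
  the level set function assigns \<open>x\<close> to material \<open>l\<close>. The optimality condition at \<open>x\<close> is therefore a
  reformulation of the fact that \<open>\<psi>\<close> represents the design.

  What remains is bookkeeping: a point of \<open>D\<close> off all material boundaries lies in some material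
  (\<open>design_covers_off_frontiers\<close>), only that material contributes to the sums over all materials
  (\<open>sum_indicat_disjoint_family\<close>), and every row of \<open>N\<close> is one of the normals that define the
  sector (\<open>other_label_in\<close>).
\<close>

text \<open>The index type has as many elements as the list of remaining labels, so no position falls off
  its end.\<close>

lemma other_label_in:
  fixes k :: "'n::{finite,linorder}"
  assumes "CARD('n) = M - 1" and "l \<in> {1..M}"
  shows "other_label M l k \<in> {1..M} - {l}"
proof -
  have "card {..<k} < CARD('n)"
    by (rule psubset_card_mono) auto
  also have "\<dots> = length (sorted_list_of_set ({1..M} - {l}))"
    using assms by simp
  finally have "other_label M l k \<in> set (sorted_list_of_set ({1..M} - {l}))"
    unfolding other_label_def by (rule nth_mem)
  then show ?thesis
    by simp
qed

lemma sum_indicat_disjoint_family: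
  fixes f :: "'i \<Rightarrow> 'b::real_vector"
  assumes "finite I" and "disjoint_family_on A I" and "l \<in> I" and "x \<in> A l"
  shows "(\<Sum>i\<in>I. indicat_real (A i) x *\<^sub>R f i) = f l"
proof -
  have "x \<notin> A i" if "i \<in> I - {l}" for i
    using assms that by (auto simp: disjoint_family_on_def)
  then have "(\<Sum>i\<in>I. indicat_real (A i) x *\<^sub>R f i) = (\<Sum>i\<in>{l}. indicat_real (A i) x *\<^sub>R f i)"
    using assms by (intro sum.mono_neutral_right) auto
  then show ?thesis
    using assms by simp
qed

text \<open>The closures of the materials cover \<open>D\<close>, and an open set differs from its closure only by its
  frontier.\<close>

lemma design_covers_off_frontiers:
  assumes "\<Omega> \<in> designs M D \<A>" and "x \<in> D - (\<Union>j\<in>{1..M}. frontier (\<Omega> j))"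
  obtains l where "l \<in> {1..M}" and "x \<in> \<Omega> l"
proof -
  have "x \<in> (\<Union>l\<in>{1..M}. closure (\<Omega> l))"
    using assms closure_subset[of D] by (auto simp: designs_def)
  then obtain l where l: "l \<in> {1..M}" "x \<in> closure (\<Omega> l)"
    by blast
  moreover have "open (\<Omega> l)"
    using assms(1) l by (simp add: designs_def)
  ultimately have "x \<in> \<Omega> l"
    using assms(2) by (auto simp: frontier_def interior_open)
  with l show thesis
    using that by blast
qed

lemma matrix_vector_mul_matrix_inv:
  fixes A :: "real ^ 'n ^ 'n"
  assumes "invertible A"
  shows "A *v (matrix_inv A *v v) = v"
proof -
  have "A ** matrix_inv A = mat 1"
    using someI_ex[OF assms[unfolded invertible_def]] unfolding matrix_inv_def by blast
  then show ?thesis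
    by (simp add: matrix_vector_mul_assoc)
qed

lemma normal_matrix_mult_pos:
  fixes n :: "nat \<Rightarrow> nat \<Rightarrow> real ^ 'n::{finite,linorder}"
  assumes "sector_decomposition M S n" and "CARD('n) = M - 1"
    and "l \<in> {1..M}" and "y \<in> S l"
  shows "(normal_matrix M n l *v y) $ k > 0"
proof -
  have "S l = {y. \<forall>j\<in>{1..M} - {l}. y \<bullet> n j l > 0}"
    using assms(1,3) unfolding sector_decomposition_def by blast
  then have "y \<bullet> n (other_label M l k) l > 0"
    using assms(4) other_label_in[OF assms(2,3)] by blast
  then show ?thesis
    by (simp add: normal_matrix_def matrix_vector_mul_component inner_commute)
qed

theorem theorem3p7:
  fixes M :: nat
    and D :: "(real ^ 'd) set"
    and \<A> :: "(real ^ 'd) set set"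
    and J :: "(nat \<Rightarrow> (real ^ 'd) set) \<Rightarrow> real"
    and \<omega> :: "(real ^ 'd) set"
    and ell :: "real \<Rightarrow> real"
    and S :: "nat \<Rightarrow> (real ^ 'n::{finite,linorder}) set"
    and n :: "nat \<Rightarrow> nat \<Rightarrow> real ^ 'n::{finite,linorder}"
    and \<Omega> :: "nat \<Rightarrow> (real ^ 'd) set"
    and \<psi> :: "real ^ 'd \<Rightarrow> real ^ 'n::{finite,linorder}"
  assumes "CARD('d) \<in> {1, 2, 3}"
    and "M > 2" and "CARD('n) = M - 1"
    and "open D" and "bounded D"
    and "\<A> \<subseteq> Pow D"
    and "open \<omega>" and "0 \<in> \<omega>"
    and "continuous_on {0<..} ell" and "\<And>\<epsilon>. \<epsilon> > 0 \<Longrightarrow> ell \<epsilon> > 0" and "(ell \<longlongrightarrow> 0) (at_right 0)"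
    and "topologically_differentiable M D \<A> J \<omega> ell"
    and "sector_decomposition M S n"
    and "\<And>l. l \<in> {1..M} \<Longrightarrow> invertible (normal_matrix M n l)"
    and "\<Omega> \<in> designs M D \<A>"
    and "represents M D S \<psi> \<Omega>"
    and "\<exists>c>0. \<forall>x\<in>(\<Union>l\<in>{1..M}. \<Omega> l).
      \<psi> x = c *\<^sub>R generalized_topological_derivative M J \<omega> ell n \<Omega> x"
  shows "locally_optimal TYPE('n) M D J \<omega> ell \<Omega>"
proof -
  have disj: "disjoint_family_on \<Omega> {1..M}"
    using \<open>\<Omega> \<in> designs M D \<A>\<close> by (simp add: designs_def)
  obtain c where "c > 0" and \<psi>: "\<And>x. x \<in> (\<Union>l\<in>{1..M}. \<Omega> l) \<Longrightarrow>
      \<psi> x = c *\<^sub>R generalized_topological_derivative M J \<omega> ell n \<Omega> x"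
    using assms(17) by blast
  have "full_topological_derivative M J \<omega> ell \<Omega> x $ k > 0"
    if x: "x \<in> D - (\<Union>j\<in>{1..M}. frontier (\<Omega> j))" for x and k :: 'n
  proof -
    obtain l where l: "l \<in> {1..M}" "x \<in> \<Omega> l"
      using design_covers_off_frontiers[OF \<open>\<Omega> \<in> designs M D \<A>\<close> x] .
    define N where "N = normal_matrix M n l"
    define T :: "real ^ 'n::{finite,linorder}" where "T = topological_derivative_vec M J \<omega> ell \<Omega> l x"
    have full: "full_topological_derivative M J \<omega> ell \<Omega> x = T"
      unfolding full_topological_derivative_def T_def
      using disj l by (intro sum_indicat_disjoint_family) auto
    have "generalized_topological_derivative M J \<omega> ell n \<Omega> x = matrix_inv N *v T"
      unfolding generalized_topological_derivative_def T_def N_def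
      using disj l by (intro sum_indicat_disjoint_family) auto
    moreover have "x \<in> (\<Union>l\<in>{1..M}. \<Omega> l)"
      using l by blast
    ultimately have "\<psi> x = c *\<^sub>R (matrix_inv N *v T)"
      using \<psi> by metis
    moreover have "invertible N"
      unfolding N_def using assms(14) l by blast
    ultimately have "N *v \<psi> x = c *\<^sub>R T"
      by (simp add: matrix_vector_mult_scaleR matrix_vector_mul_matrix_inv)
    moreover have "\<psi> x \<in> S l"
      using \<open>represents M D S \<psi> \<Omega>\<close> l x by (auto simp: represents_def)
    then have "(N *v \<psi> x) $ k > 0"
      unfolding N_def
      using \<open>sector_decomposition M S n\<close> \<open>CARD('n) = M - 1\<close> l by (intro normal_matrix_mult_pos)
    ultimately have "T $ k > 0"
      using \<open>c > 0\<close> by (simp add: zero_less_mult_iff)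
    then show ?thesis
      using full by simp
  qed
  then show ?thesis
    unfolding locally_optimal_def by blast
qed

end
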